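(* Let $p,q>0$ be real numbers with $\frac1p+\frac1q=1$, let $X_1,X_2$ be separable reflexive Banach spaces, let $(\psi_k)\subseteq X_1^*$ be a $p$-Bessel sequence for $X_1$ with bound $B_1$, and let $(\phi_k)\subseteq X_2$ be a $q$-Bessel sequence for $X_2^*$ with bound $B_2$ (both indexed by the same countable set). For a bounded scalar sequence $m=(m_k)$ let $\mathbf{M}=\mathbf{M}_{m,(\phi_k),(\psi_k)}:X_1\to X_2$ be the $(p,q)$-Bessel multiplier given by $\mathbf{M}_{m,(\phi_k),(\psi_k)}(f)=\sum_k m_k\,\psi_k(f)\,\phi_k$. Then the following hold. (1) If $m\in\ell^\infty$, then $\mathbf{M}$ is a well-defined bounded operator with $\|\mathbf{M}\|_{Op}\le B_2B_1\|m\|_\infty$. Furthermore, the sum $\sum_k m_k\psi_k(f)\phi_k$ converges unconditionally for all $f\in X_1$. (2) $\mathbf{M}_{m,(\phi_k),(\psi_k)}^{*}=\sum_k \overline{m_k}\,\psi_k\otimes\kappa(\phi_k)=\mathbf{M}_{\overline{m},(\psi_k),(\kappa(\phi_k))}$, where $\overline{m}=(\overline{m_k})$ is the complex conjugate sequence. (3) If $m\in\mathbf{c}_0$, i.e. $m$ converges to zero, then $\mathbf{M}$ is a compact operator.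
   Context: A countable family $(g_i)\subseteq X^*$ is a $p$-Bessel sequence for a Banach space $X$ ($1<p<\infty$) with bound $B>0$ if $\left(\sum_i|g_i(f)|^p\right)^{1/p}\le B\|f\|_X$ for all $f\in X$. For a family $(\phi_k)\subseteq X_2$ to be a $q$-Bessel sequence for $X_2^*$ with bound $B_2$, one identifies $X_2$ with $X_2^{**}$, so it means $\left(\sum_k|h(\phi_k)|^q\right)^{1/q}\le B_2\|h\|_{X_2^*}$ for all $h\in X_2^*$. For $y\in Y$ and $\omega\in X^*$, $y\otimes\omega:X\to Y$ is the operator $z\mapsto\omega(z)y$. The map $\kappa:Y\to Y^{**}$ is the canonical injection, $\kappa(y)(\eta)=\eta(y)$ for $\eta\in Y^*$. For a bounded operator $T:X\to Y$, $T^*:Y^*\to X^*$ denotes its adjoint, $T^*(\eta)=\eta\circ T$; for the operators $y\otimes\omega$ one has $(y\otimes\omega)^*=\omega\otimes\kappa(y)$. Accordingly $\mathbf{M}_{\overline{m},(\psi_k),(\kappa(\phi_k))}:X_2^*\to X_1^*$ is the operator $\eta\mapsto\sum_k\overline{m_k}\,\kappa(\phi_k)(\eta)\,\psi_k$. $\|\cdot\|_{Op}$ is the operator norm.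
   Formalization: Item (2) fails as printed for non-real m (X1=X2=C, m=i: M* is i, not -i). Proved instead: M* = sum of m_k psi_k⊗kappa(phi_k), pointwise on X_2^*; the conjugated formula for real m, and for all m on conjugate-linear functionals with psi_k conjugated. *)

theory Defs
  imports "HOL-Analysis.Analysis"
begin

(* The scalar field K: the real numbers with trivial conjugation, or the complex numbers.
   The instances below and lemma real_or_complex_cases show that nothing else is meant. *)

class real_or_complex = real_normed_field + banach + heine_borel +
  fixes conjg :: "'a \<Rightarrow> 'a"
  assumes conjg_add: "conjg (x + y) = conjg x + conjg y"
    and conjg_mult: "conjg (x * y) = conjg x * conjg y"
    and conjg_scaleR_1: "conjg (r *\<^sub>R 1) = r *\<^sub>R 1"
    and mult_conjg_scaleR: "x * conjg x = (norm x)\<^sup>2 *\<^sub>R 1"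
    and add_conjg_scaleR: "\<exists>r. x + conjg x = r *\<^sub>R 1"

instantiation real :: real_or_complex
begin
definition conjg_real :: "real \<Rightarrow> real" where "conjg_real x = x"
instance by standard (auto simp: conjg_real_def power2_eq_square)
end

instantiation complex :: real_or_complex
begin
definition conjg_complex :: "complex \<Rightarrow> complex" where "conjg_complex = cnj"
instance
proof
  fix x :: complex
  show "x * conjg x = (norm x)\<^sup>2 *\<^sub>R 1"
    by (simp add: conjg_complex_def complex_norm_square[symmetric] scaleR_conv_of_real)
  show "\<exists>r. x + conjg x = r *\<^sub>R 1"
    by (intro exI[of _ "2 * Re x"]) (simp add: conjg_complex_def complex_eq_iff)
qed (auto simp: conjg_complex_def scaleR_conv_of_real)
end

lemma conjg_of_real: "conjg (of_real r) = (of_real r :: 'k::real_or_complex)"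
  by (simp add: of_real_def conjg_scaleR_1)

lemma mult_conjg: "x * conjg x = of_real ((norm (x::'k::real_or_complex))\<^sup>2)"
  by (simp only: of_real_def mult_conjg_scaleR)

lemma add_conjg_Reals: "(x::'k::real_or_complex) + conjg x \<in> \<real>"
  using add_conjg_scaleR[of x] by (auto simp: of_real_def[symmetric])

lemma real_or_complex_cases:
  "(\<forall>x::'k::real_or_complex. x \<in> \<real> \<and> conjg x = x) \<or>
   (\<exists>i::'k. i * i = -1 \<and> conjg i = - i \<and> (\<forall>x. \<exists>a b. x = of_real a + of_real b * i))"
proof -
  have real: "conjg x = x" if "x \<in> \<real>" for x :: 'k
    using that by (auto elim!: Reals_cases simp: conjg_of_real)
  have cc: "conjg (conjg x) = x" for x :: 'k
  proof -
    have "conjg (x + conjg x) = x + conjg x" by (intro real add_conjg_Reals)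
    then show ?thesis by (simp add: conjg_add)
  qed
  have half: "(x + conjg x) / 2 \<in> \<real>" for x :: 'k
    by (intro Reals_divide add_conjg_Reals) auto
  have neg: "conjg (- x) = - conjg x" for x :: 'k
    using conjg_mult[of "of_real (-1)" x] by (simp add: conjg_of_real del: of_real_minus) simp
  show ?thesis
  proof (cases "\<forall>x::'k. conjg x = x")
    case True
    then show ?thesis using half by auto
  next
    case False
    then obtain x :: 'k where x: "conjg x \<noteq> x" by blast
    define y where "y = x - conjg x"
    have y0: "y \<noteq> 0" using x by (simp add: y_def)
    have cy: "conjg y = - y"
      using conjg_add[of x "- conjg x"] by (simp add: y_def neg cc)
    have yy: "y * y = - of_real ((norm y)\<^sup>2)"
      using mult_conjg[of y] by (simp add: cy) (metis minus_minus)
    define i where "i = of_real (inverse (norm y)) * y"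
    have ii: "i * i = -1"
    proof -
      have "i * i = of_real (inverse (norm y))^2 * (y * y)"
        by (simp add: i_def power2_eq_square mult_ac)
      also have "\<dots> = - of_real ((inverse (norm y))\<^sup>2 * (norm y)\<^sup>2)"
        unfolding yy of_real_mult of_real_power by simp
      also have "(inverse (norm y))\<^sup>2 * (norm y)\<^sup>2 = 1"
        using y0 by (simp add: power_mult_distrib[symmetric])
      finally show ?thesis by simp
    qed
    have ci: "conjg i = - i" by (simp only: i_def conjg_mult conjg_of_real cy) simp
    have "\<exists>a b. z = of_real a + of_real b * i" for z :: 'k
    proof -
      let ?w = "- (i * z)"
      obtain a where a: "(z + conjg z) / 2 = of_real a" using half[of z] by (auto elim!: Reals_cases)
      obtain b where b: "(?w + conjg ?w) / 2 = of_real b" using half[of ?w] by (auto elim!: Reals_cases)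
      have "conjg ?w = i * conjg z" by (simp add: neg conjg_mult ci)
      then have "of_real b * i = (- (i * z) + i * conjg z) / 2 * i" using b by simp
      also have "\<dots> = (i * i) * (conjg z - z) / 2" by (simp add: field_simps)
      also have "\<dots> = (z - conjg z) / 2" by (simp add: ii)
      finally have "of_real a + of_real b * i = (z + conjg z) / 2 + (z - conjg z) / 2"
        using a by simp
      also have "\<dots> = z" by (simp add: add_divide_distrib[symmetric])
      finally have "z = of_real a + of_real b * i" by simp
      then show ?thesis by blast
    qed
    then show ?thesis using ii ci by blast
  qed
qed


(* A Banach space over K is a type of class banach (its underlying real Banach space) together
   with a multiplication s by scalars from K that extends the real one. *)

definition K_Banach :: "('k::real_or_complex \<Rightarrow> 'a::banach \<Rightarrow> 'a) \<Rightarrow> bool" where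
  "K_Banach s \<longleftrightarrow> vector_space s \<and> (\<forall>r x. s (of_real r) x = r *\<^sub>R x)
     \<and> (\<forall>c x. norm (s c x) = norm c * norm x)"

(* The topological dual X^*, as a closed subspace of the Banach space 'a =>L 'k of all bounded
   real-linear maps into K; its norm is the operator norm. *)

definition dual :: "('k::real_or_complex \<Rightarrow> 'a::banach \<Rightarrow> 'a) \<Rightarrow> ('a \<Rightarrow>\<^sub>L 'k) set" where
  "dual s = {g. Vector_Spaces.linear s (*) (blinfun_apply g)}"

definition scale_dual :: "'k::real_or_complex \<Rightarrow> ('a::banach \<Rightarrow>\<^sub>L 'k) \<Rightarrow> ('a \<Rightarrow>\<^sub>L 'k)" where
  "scale_dual c g = blinfun_mult_right c o\<^sub>L g"

(* Elements of the dual of a subspace S, e.g. of S = dual s; values outside S are irrelevant. *)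

definition functional_on ::
    "'a::real_normed_vector set \<Rightarrow> ('k::real_or_complex \<Rightarrow> 'a \<Rightarrow> 'a) \<Rightarrow> ('a \<Rightarrow> 'k) \<Rightarrow> bool" where
  "functional_on S s g \<longleftrightarrow> (\<forall>x\<in>S. \<forall>y\<in>S. g (x + y) = g x + g y)
     \<and> (\<forall>c. \<forall>x\<in>S. g (s c x) = c * g x) \<and> (\<exists>C. \<forall>x\<in>S. norm (g x) \<le> C * norm x)"

definition kappa :: "'a::banach \<Rightarrow> ('a \<Rightarrow>\<^sub>L 'k::real_or_complex) \<Rightarrow> 'k" where
  "kappa y = (\<lambda>\<eta>. blinfun_apply \<eta> y)"

definition reflexive :: "('k::real_or_complex \<Rightarrow> 'a::banach \<Rightarrow> 'a) \<Rightarrow> bool" where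
  "reflexive s \<longleftrightarrow>
     (\<forall>\<Lambda>. functional_on (dual s) scale_dual \<Lambda> \<longrightarrow> (\<exists>x. \<forall>\<eta>\<in>dual s. \<Lambda> \<eta> = kappa x \<eta>))"

(* (g i), i in I, is a p-Bessel sequence with bound B for the space S *)

definition p_Bessel :: "'a::real_normed_vector set \<Rightarrow> ('k::real_or_complex \<Rightarrow> 'a \<Rightarrow> 'a) \<Rightarrow>
    real \<Rightarrow> real \<Rightarrow> 'i set \<Rightarrow> ('i \<Rightarrow> 'a \<Rightarrow> 'k) \<Rightarrow> bool" where
  "p_Bessel S s p B I g \<longleftrightarrow> countable I \<and> (\<forall>i\<in>I. functional_on S s (g i)) \<and> B > 0 \<and>
     (\<forall>f\<in>S. (\<lambda>i. norm (g i f) powr p) summable_on I \<and>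
            (\<Sum>\<^sub>\<infinity>i\<in>I. norm (g i f) powr p) powr (1 / p) \<le> B * norm f)"

definition linf :: "'i set \<Rightarrow> ('i \<Rightarrow> 'k::real_or_complex) set" where
  "linf I = {m. bounded (m ` I)}"

(* 0 is inserted only to give the right value for empty I. *)

definition linf_norm :: "'i set \<Rightarrow> ('i \<Rightarrow> 'k::real_or_complex) \<Rightarrow> real" where
  "linf_norm I m = Sup (insert 0 ((\<lambda>k. norm (m k)) ` I))"

(* m converges to zero along I: only finitely many k in I have |m k| >= e, for each e > 0.
   For I = UNIV :: nat set this is m ----> 0. *)

definition c0 :: "'i set \<Rightarrow> ('i \<Rightarrow> 'k::real_or_complex) set" where
  "c0 I = {m. (m \<longlongrightarrow> 0) (inf cofinite (principal I))}"

(* s is the scalar multiplication of the target space. Sums over I are limits of the net of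
   finite partial sums, hence unconditional. *)

definition multiplier :: "('k::real_or_complex \<Rightarrow> 'b::banach \<Rightarrow> 'b) \<Rightarrow> 'i set \<Rightarrow> ('i \<Rightarrow> 'k) \<Rightarrow>
    ('i \<Rightarrow> 'b) \<Rightarrow> ('i \<Rightarrow> 'a \<Rightarrow> 'k) \<Rightarrow> 'a \<Rightarrow> 'b" where
  "multiplier s I m \<phi> \<psi> f = (\<Sum>\<^sub>\<infinity>k\<in>I. s (m k * \<psi> k f) (\<phi> k))"

(* y \<otimes> \<omega>, where s is the scalar multiplication of the space of y *)

definition tensor :: "('k \<Rightarrow> 'b \<Rightarrow> 'b) \<Rightarrow> 'b \<Rightarrow> ('a \<Rightarrow> 'k) \<Rightarrow> 'a \<Rightarrow> 'b" where
  "tensor s y \<omega> = (\<lambda>z. s (\<omega> z) y)"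

(* T^*(\<eta>) = \<eta> o T; meaningful for bounded linear T. *)

definition dual_adjoint :: "('a::banach \<Rightarrow> 'b::banach) \<Rightarrow> ('b \<Rightarrow>\<^sub>L 'k::real_or_complex) \<Rightarrow> ('a \<Rightarrow>\<^sub>L 'k)" where
  "dual_adjoint T \<eta> = Blinfun (\<lambda>x. blinfun_apply \<eta> (T x))"

definition compact_operator :: "('a::real_normed_vector \<Rightarrow> 'b::real_normed_vector) \<Rightarrow> bool" where
  "compact_operator T \<longleftrightarrow> bounded_linear T \<and> (\<forall>S. bounded S \<longrightarrow> compact (closure (T ` S)))"

(* Conjugate-linear functionals. With linear functionals, (y \<otimes> \<omega>)^* = \<omega> \<otimes> kappa y gives
   (c (y \<otimes> \<omega>))^* = c (\<omega> \<otimes> kappa y) without a conjugate; conjugates of non-real scalars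
   appear in an adjoint T^*(\<eta>) = \<eta> o T when \<eta> is conjugate-linear, in which case a linear
   functional \<psi> is represented by conj_functional \<psi>. Over the reals,
   antidual s = dual s and conj_functional \<psi> = \<psi>. *)

definition antidual :: "('k::real_or_complex \<Rightarrow> 'a::banach \<Rightarrow> 'a) \<Rightarrow> ('a \<Rightarrow>\<^sub>L 'k) set" where
  "antidual s = {g. \<forall>c x. blinfun_apply g (s c x) = conjg c * blinfun_apply g x}"

definition conj_functional :: "('a::banach \<Rightarrow>\<^sub>L 'k::real_or_complex) \<Rightarrow> ('a \<Rightarrow>\<^sub>L 'k)" where
  "conj_functional g = Blinfun (\<lambda>x. conjg (blinfun_apply g x))"

end

theory Submission
  imports Defs
begin

text \<open>A multiplier factors through a sequence space: analysis \<open>f \<mapsto> (\<psi> k f)\<close> maps the domain to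
\<open>l\<^sup>p\<close>, multiplication by a bounded symbol preserves \<open>l\<^sup>p\<close>, and synthesis
\<open>c \<mapsto> (\<Sum>k. c k \<phi> k)\<close> maps \<open>l\<^sup>p\<close> to the target. The Bessel condition on \<open>\<psi>\<close> bounds
analysis by definition. Synthesis is dual to the analysis of functionals \<open>\<eta> \<mapsto> (\<eta> (\<phi> k))\<close>
into \<open>l\<^sup>q\<close>, so Hoelder's inequality bounds \<open>\<eta>\<close> of any finite sum \<open>\<Sum>k. c k \<phi> k\<close>, and the
Hahn-Banach theorem (\<open>norming_functional\<close>) turns this into a bound on the norm of the sum
(\<open>synthesis_bound_of_Bessel\<close>). Applied to finite sums far out in the index set, that bound is a
Cauchy criterion, which gives unconditional convergence (\<open>synthesis_summable\<close>); in the limit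
it becomes the operator norm estimate (\<open>multiplier_summable_and_bound\<close>).

The adjoint series has the same shape with \<open>p\<close>, \<open>q\<close> and \<open>\<phi>\<close>, \<open>\<psi>\<close> exchanged, so it converges
in norm once synthesis by \<open>\<psi>\<close> is bounded, which follows from Hoelder's inequality by testing on
vectors (\<open>synthesis_bound_of_Bessel_dual\<close>); its sum is found by evaluating at points (\<open>has_sum_adjoint\<close>).
For conjugate-linear functionals everything is transported by conjugation.

If the symbol tends to zero, cutting off its finitely many values of size at least \<open>d\<close> leaves
an operator of norm at most \<open>B\<^sub>2 * B\<^sub>1 * d\<close>. Hence the image of a bounded set is
within any positive distance of a set of bounded combinations of finitely many vectors, which is
compact; so the image is totally bounded.

The Hahn-Banach theorem is obtained from minimal sublinear functionals, which are automatically
linear; the passage from real to complex functionals is the usual one.\<close>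

section \<open>The real Hahn-Banach theorem\<close>

text \<open>Positive homogeneity is required only as an inequality, which is preserved more easily by
infima; applied to both \<open>r\<close> and \<open>inverse r\<close> it gives equality.\<close>
definition sublinear :: "('a::real_vector \<Rightarrow> real) \<Rightarrow> bool" where
  "sublinear p \<longleftrightarrow> (\<forall>x y. p (x + y) \<le> p x + p y) \<and> (\<forall>r x. r > 0 \<longrightarrow> p (r *\<^sub>R x) \<le> r * p x)"

lemma sublinear_add: "sublinear p \<Longrightarrow> p (x + y) \<le> p x + p y"
  by (simp add: sublinear_def)

lemma sublinear_scaleR: 
  assumes "sublinear p" "r > 0"
  shows "p (r *\<^sub>R x) = r * p x"
proof (rule antisym)
  have "p (inverse r *\<^sub>R (r *\<^sub>R x)) \<le> inverse r * p (r *\<^sub>R x)"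
    using assms unfolding sublinear_def by (metis positive_imp_inverse_positive)
  then show "r * p x \<le> p (r *\<^sub>R x)"
    using assms(2) by (simp add: field_simps)
qed (use assms in \<open>simp add: sublinear_def\<close>)

lemma sublinear_0: 
  assumes "sublinear p" shows "p 0 = 0"
  using sublinear_scaleR[OF assms, of 2 0] by simp

lemma sublinear_ge_minus:
  assumes "sublinear p" shows "- p (- x) \<le> p x"
  using sublinear_add[OF assms, of x "- x"] sublinear_0[OF assms] by simp

text \<open>The largest sublinear functional below \<open>p\<close> whose value at \<open>- y\<close> is at most \<open>- p y\<close>. If \<open>p\<close>
itself is the only sublinear functional below \<open>p\<close>, then this shift equals \<open>p\<close>, and the bound
at \<open>t = 1\<close> says \<open>p x + p y \<le> p (x + y)\<close>: a minimal sublinear functional is linear. The same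
construction applied to the norm forces a linear functional below it to attain the norm at \<open>y\<close>.\<close>
definition sublinear_shift :: "('a::real_vector \<Rightarrow> real) \<Rightarrow> 'a \<Rightarrow> 'a \<Rightarrow> real" where
  "sublinear_shift p y x = (INF t\<in>{0..}. p (x + t *\<^sub>R y) - t * p y)"

text \<open>The infimum is over a set bounded below by \<open>- p (- x)\<close>, because
\<open>t * p y = p (t *\<^sub>R y) \<le> p (x + t *\<^sub>R y) + p (- x)\<close>.\<close>
lemma sublinear_shift_le:
  assumes "sublinear p" "t \<ge> 0"
  shows "sublinear_shift p y x \<le> p (x + t *\<^sub>R y) - t * p y"
  unfolding sublinear_shift_def
proof (rule cINF_lower)
  show "bdd_below ((\<lambda>t. p (x + t *\<^sub>R y) - t * p y) ` {0..})"
  proof (rule bdd_belowI2)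
    fix t :: real assume "t \<in> {0..}"
    then have "p (t *\<^sub>R y) = t * p y"
      using sublinear_scaleR[OF assms(1), of t y] sublinear_0[OF assms(1)] by (cases "t = 0") auto
    moreover have "p (t *\<^sub>R y) \<le> p (x + t *\<^sub>R y) + p (- x)"
      using sublinear_add[OF assms(1), of "x + t *\<^sub>R y" "- x"] by simp
    ultimately show "- p (- x) \<le> p (x + t *\<^sub>R y) - t * p y" by simp
  qed
qed (use assms in auto)

lemma le_sublinear_shift:
  assumes "\<And>t. t \<ge> 0 \<Longrightarrow> c \<le> p (x + t *\<^sub>R y) - t * p y"
  shows "c \<le> sublinear_shift p y x"
  unfolding sublinear_shift_def using assms by (intro cINF_greatest) auto

lemma sublinear_sublinear_shift:
  assumes p: "sublinear p"
  shows "sublinear (sublinear_shift p y)"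
  unfolding sublinear_def
proof (intro conjI allI impI)
  fix x z
  have "sublinear_shift p y (x + z) - (p (z + t *\<^sub>R y) - t * p y) \<le> p (x + s *\<^sub>R y) - s * p y"
    if "s \<ge> 0" "t \<ge> 0" for s t
  proof -
    have "sublinear_shift p y (x + z) \<le> p ((x + z) + (s + t) *\<^sub>R y) - (s + t) * p y"
      using that by (intro sublinear_shift_le p) auto
    also have "(x + z) + (s + t) *\<^sub>R y = (x + s *\<^sub>R y) + (z + t *\<^sub>R y)"
      by (simp add: algebra_simps)
    finally show ?thesis
      using sublinear_add[OF p, of "x + s *\<^sub>R y" "z + t *\<^sub>R y"] by (simp add: algebra_simps)
  qed
  then have "sublinear_shift p y (x + z) - (p (z + t *\<^sub>R y) - t * p y) \<le> sublinear_shift p y x"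
    if "t \<ge> 0" for t
    using that by (intro le_sublinear_shift) auto
  then have "sublinear_shift p y (x + z) - sublinear_shift p y x \<le> sublinear_shift p y z"
    by (intro le_sublinear_shift) (smt (verit))
  then show "sublinear_shift p y (x + z) \<le> sublinear_shift p y x + sublinear_shift p y z"
    by simp
next
  fix r :: real and x assume r: "r > 0"
  have "sublinear_shift p y (r *\<^sub>R x) / r \<le> sublinear_shift p y x"
  proof (rule le_sublinear_shift)
    fix t :: real assume "t \<ge> 0"
    then have "sublinear_shift p y (r *\<^sub>R x) \<le> p (r *\<^sub>R x + (r * t) *\<^sub>R y) - (r * t) * p y"
      using r by (intro sublinear_shift_le p) auto
    also have "r *\<^sub>R x + (r * t) *\<^sub>R y = r *\<^sub>R (x + t *\<^sub>R y)"
      by (simp add: algebra_simps)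
    also have "p \<dots> = r * p (x + t *\<^sub>R y)"
      by (rule sublinear_scaleR[OF p r])
    finally show "sublinear_shift p y (r *\<^sub>R x) / r \<le> p (x + t *\<^sub>R y) - t * p y"
      using r by (simp add: field_simps)
  qed
  then show "sublinear_shift p y (r *\<^sub>R x) \<le> r * sublinear_shift p y x"
    using r by (simp add: field_simps)
qed

text \<open>Comparability makes the pointwise infimum subadditive: given \<open>f\<close> nearly optimal at \<open>x\<close> and \<open>g\<close>
nearly optimal at \<open>y\<close>, the smaller of the two is nearly optimal at both points.
The common upper bound \<open>p\<close> also bounds the values below, since \<open>f x \<ge> - f (- x) \<ge> - p (- x)\<close>.\<close>
lemma sublinear_INF_chain:
  assumes "C \<noteq> {}" and sub: "\<And>f. f \<in> C \<Longrightarrow> sublinear f"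
    and dom: "\<And>f x. f \<in> C \<Longrightarrow> f x \<le> p x"
    and chain: "\<And>f g. f \<in> C \<Longrightarrow> g \<in> C \<Longrightarrow> (\<forall>x. f x \<le> g x) \<or> (\<forall>x. g x \<le> f x)"
  shows "sublinear (\<lambda>x. INF f\<in>C. f x)" and "f \<in> C \<Longrightarrow> (INF f\<in>C. f x) \<le> f x"
proof -
  have low: "(INF f\<in>C. f x) \<le> f x" if "f \<in> C" for f x
  proof (rule cINF_lower[OF _ that])
    show "bdd_below ((\<lambda>f. f x) ` C)"
    proof (rule bdd_belowI2)
      fix f assume "f \<in> C"
      then show "- p (- x) \<le> f x"
        using sublinear_ge_minus[OF sub, of f x] dom[of f "- x"] by linarith
    qed
  qed
  then show "f \<in> C \<Longrightarrow> (INF f\<in>C. f x) \<le> f x" .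
  show "sublinear (\<lambda>x. INF f\<in>C. f x)"
    unfolding sublinear_def
  proof (intro conjI allI impI)
    fix x y
    have "(INF f\<in>C. f (x + y)) - g y \<le> f x" if "f \<in> C" "g \<in> C" for f g
    proof -
      obtain h where "h \<in> C" "h x \<le> f x" "h y \<le> g y"
        using chain[OF \<open>f \<in> C\<close> \<open>g \<in> C\<close>] \<open>f \<in> C\<close> \<open>g \<in> C\<close> by (metis order_refl)
      with low[of h "x + y"] sublinear_add[OF sub, of h x y] show ?thesis by linarith
    qed
    then have "(INF f\<in>C. f (x + y)) - g y \<le> (INF f\<in>C. f x)" if "g \<in> C" for g
      using assms(1) that by (intro cINF_greatest) auto
    then have "(INF f\<in>C. f (x + y)) - (INF f\<in>C. f x) \<le> (INF f\<in>C. f y)"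
      using assms(1) by (intro cINF_greatest) (auto simp: algebra_simps)
    then show "(INF f\<in>C. f (x + y)) \<le> (INF f\<in>C. f x) + (INF f\<in>C. f y)" by simp
  next
    fix r :: real and x assume r: "r > 0"
    have "(INF f\<in>C. f (r *\<^sub>R x)) / r \<le> (INF f\<in>C. f x)"
    proof (rule cINF_greatest[OF assms(1)])
      fix f assume "f \<in> C"
      with low[of f "r *\<^sub>R x"] sublinear_scaleR[OF sub r, of f x] r
      show "(INF f\<in>C. f (r *\<^sub>R x)) / r \<le> f x" by (simp add: field_simps)
    qed
    then show "(INF f\<in>C. f (r *\<^sub>R x)) \<le> r * (INF f\<in>C. f x)"
      using r by (simp add: field_simps)
  qed
qed

text \<open>The analytic Hahn-Banach theorem by minimality instead of extension from subspaces: by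
Zorn's lemma there is a minimal sublinear functional below \<open>p\<close>, and minimality makes it linear.\<close>
lemma linear_below_sublinear:
  fixes p :: "'a::real_vector \<Rightarrow> real"
  assumes "sublinear p"
  shows "\<exists>g. linear g \<and> (\<forall>x. g x \<le> p x)"
proof -
  define A where "A = {f. sublinear f \<and> (\<forall>x. f x \<le> p x)}"
  define P where "P = (\<lambda>f g :: 'a \<Rightarrow> real. \<forall>x. g x \<le> f x)"
  have "\<exists>g\<in>A. \<forall>f\<in>A. P g f \<longrightarrow> f = g"
  proof (rule predicate_Zorn)
    show "partial_order_on A (relation_of P A)"
      by (rule partial_order_on_relation_ofI) (auto simp: P_def fun_eq_iff intro: order_trans antisym)
  next
    fix C assume "C \<in> Chains (relation_of P A)"
    then have CA: "C \<subseteq> A" and ch: "\<And>f g. f \<in> C \<Longrightarrow> g \<in> C \<Longrightarrow> P f g \<or> P g f"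
      by (auto simp: Chains_def relation_of_def)
    show "\<exists>u\<in>A. \<forall>f\<in>C. P f u"
    proof (cases "C = {}")
      case True
      then show ?thesis using assms by (auto simp: A_def)
    next
      case False
      have C: "\<And>f. f \<in> C \<Longrightarrow> sublinear f" "\<And>f x. f \<in> C \<Longrightarrow> f x \<le> p x"
        "\<And>f g. f \<in> C \<Longrightarrow> g \<in> C \<Longrightarrow> (\<forall>x. f x \<le> g x) \<or> (\<forall>x. g x \<le> f x)"
        using CA ch by (auto simp: A_def P_def)
      have *: "sublinear (\<lambda>x. INF f\<in>C. f x)"
        by (rule sublinear_INF_chain(1)[where p = p]) (use False C in blast)+
      have **: "(INF f\<in>C. f x) \<le> f x" if "f \<in> C" for f x
        by (rule sublinear_INF_chain(2)[where p = p]) (use False C that in blast)+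
      obtain f where "f \<in> C" using False by blast
      then have "(INF f\<in>C. f x) \<le> p x" for x
        using **[OF \<open>f \<in> C\<close>, of x] C(2)[OF \<open>f \<in> C\<close>, of x] by linarith
      then have "(\<lambda>x. INF f\<in>C. f x) \<in> A"
        using * by (simp add: A_def)
      then show ?thesis using ** by (intro bexI) (auto simp: P_def)
    qed
  qed
  then obtain g where "g \<in> A" and minA: "\<And>f. f \<in> A \<Longrightarrow> P g f \<Longrightarrow> f = g"
    by blast
  then have g: "sublinear g" "\<And>x. g x \<le> p x" by (auto simp: A_def)
  have min: "f = g" if "sublinear f" "\<And>x. f x \<le> g x" for f
    using that g(2) by (intro minA) (auto simp: A_def P_def intro: order_trans)
  \<comment> \<open>Shifting cannot decrease a minimal functional, and for \<open>t = 1\<close> this is superadditivity.\<close>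
  have add: "g (x + y) = g x + g y" for x y
  proof -
    have "sublinear_shift g y = g"
    proof (rule min[OF sublinear_sublinear_shift[OF g(1)]])
      show "sublinear_shift g y x \<le> g x" for x
        using sublinear_shift_le[OF g(1), of 0 y x] by simp
    qed
    then have "g x \<le> g (x + y) - g y"
      using sublinear_shift_le[OF g(1), of 1 y x] by simp
    then show ?thesis using sublinear_add[OF g(1), of x y] by simp
  qed
  have neg: "g (- x) = - g x" for x
    using add[of x "- x"] sublinear_0[OF g(1)] by simp
  have "g (r *\<^sub>R x) = r * g x" for r x
  proof -
    consider "r > 0" | "r = 0" | "- r > 0" by linarith
    then show ?thesis
    proof cases
      case 3
      then have "g ((- r) *\<^sub>R x) = - r * g x" by (rule sublinear_scaleR[OF g(1)])
      then show ?thesis using neg[of "r *\<^sub>R x"] by simp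
    qed (use sublinear_scaleR[OF g(1)] sublinear_0[OF g(1)] in auto)
  qed
  then have "linear g" using add by (intro linearI) auto
  then show ?thesis using g by blast
qed

lemma real_norming_functional:
  fixes y :: "'a::real_normed_vector"
  shows "\<exists>g. linear g \<and> (\<forall>x. g x \<le> norm x) \<and> g y = norm y"
proof -
  have norm: "sublinear (norm :: 'a \<Rightarrow> real)"
    by (auto simp: sublinear_def norm_triangle_ineq)
  obtain g where g: "linear g" "\<And>x. g x \<le> sublinear_shift norm y x"
    using linear_below_sublinear[OF sublinear_sublinear_shift[OF norm]] by blast
  have le: "g x \<le> norm x" for x
    using g(2)[of x] sublinear_shift_le[OF norm, of 0 y x] by simp
  have "g (- y) \<le> - norm y"
    using g(2)[of "- y"] sublinear_shift_le[OF norm, of 1 y "- y"] by simp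
  then have "norm y \<le> g y" using linear_neg[OF g(1)] by simp
  then show ?thesis using g(1) le[of y] le by (intro exI[of _ g]) (auto intro: antisym)
qed

section \<open>Scalars and the Hahn-Banach theorem over them\<close>

lemma conjg_0 [simp]: "conjg (0::'k::real_or_complex) = 0"
  using conjg_of_real[of 0, where 'k='k] by simp

lemma conjg_minus: "conjg (- x) = - conjg (x::'k::real_or_complex)"
  using conjg_add[of x "- x"] by (simp add: eq_neg_iff_add_eq_0 add.commute)

lemma norm_conjg [simp]: "norm (conjg x) = norm (x::'k::real_or_complex)"
proof (cases "x = 0")
  case False
  have "norm x * norm (conjg x) = norm x * norm x"
    using mult_conjg[of x] by (simp add: norm_mult[symmetric] power2_eq_square)
  then show ?thesis using False by simp
qed simp

lemma conjg_conjg [simp]: "conjg (conjg x) = (x::'k::real_or_complex)"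
proof (cases "x = 0")
  case False
  have "conjg x * conjg (conjg x) = conjg x * x"
    using mult_conjg[of x] mult_conjg[of "conjg x"] by (simp add: mult.commute)
  moreover have "conjg x \<noteq> 0" using False norm_conjg[of x] by (metis norm_eq_zero)
  ultimately show ?thesis by simp
qed simp

lemma bounded_linear_conjg: "bounded_linear (conjg :: 'k::real_or_complex \<Rightarrow> 'k)"
  by (intro bounded_linear_intro[of _ 1])
     (auto simp: conjg_add conjg_mult conjg_of_real scaleR_conv_of_real)

context
  fixes s :: "'k::real_or_complex \<Rightarrow> 'a::banach \<Rightarrow> 'a"
  assumes s: "K_Banach s"
begin

lemma K_Banach_norm: "norm (s c x) = norm c * norm x"
  and K_Banach_of_real: "s (of_real r) x = r *\<^sub>R x"
  and K_Banach_vector_space: "vector_space s"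
  using s by (auto simp: K_Banach_def)

interpretation vector_space s by (rule K_Banach_vector_space)

lemmas K_Banach_zero_left = scale_zero_left

lemma K_Banach_scaleR: "s (r *\<^sub>R c) x = r *\<^sub>R s c x" "s c (r *\<^sub>R x) = r *\<^sub>R s c x"
  by (simp_all add: K_Banach_of_real[symmetric] scaleR_conv_of_real mult.commute)

lemma bounded_linear_K_Banach_left: "bounded_linear (\<lambda>c. s c x)"
  by (intro bounded_linear_intro[of _ "norm x"])
     (auto simp: scale_left_distrib K_Banach_scaleR K_Banach_norm)

lemma bounded_linear_K_Banach_right: "bounded_linear (s c)"
  by (intro bounded_linear_intro[of _ "norm c"])
     (auto simp: scale_right_distrib K_Banach_scaleR K_Banach_norm)

lemma linear_K_BanachI:
  fixes g :: "'a \<Rightarrow> 'k"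
  assumes "\<And>x y. g (x + y) = g x + g y" "\<And>c x. g (s c x) = c * g x"
  shows "Vector_Spaces.linear s (*) g"
  unfolding Vector_Spaces.linear_iff using assms K_Banach_vector_space
  by (auto simp: vector_space_def algebra_simps)

text \<open>A real norming functional \<open>g\<close> is the real part of a \<open>\<real>\<close>- or \<open>\<complex>\<close>-linear one:
over the complex numbers, of \<open>x \<mapsto> g x - i * g (i x)\<close>. Both scalar fields are captured
by the single relation \<open>h x + conjg (h x) = 2 * g x\<close>, from which both norm
estimates follow by linearity.\<close>
lemma norming_functional:
  fixes y :: 'a
  shows "\<exists>\<eta>\<in>dual s. (\<forall>x. norm (blinfun_apply \<eta> x) \<le> norm x) \<and> norm y \<le> norm (blinfun_apply \<eta> y)"
proof -
  obtain g where g: "linear g" "\<And>x. g x \<le> norm x" "g y = norm y"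
    using real_norming_functional[of y] by blast
  have gabs: "\<bar>g x\<bar> \<le> norm x" for x
    using g(2)[of x] g(2)[of "- x"] linear_neg[OF g(1), of x] by simp
  have "\<exists>h. (\<forall>x z. h (x + z) = h x + h z) \<and> (\<forall>c x. h (s c x) = c * h x) \<and>
    (\<forall>x. h x + conjg (h x) = of_real (2 * g x))"
    using real_or_complex_cases[where 'k='k]
  proof (elim disjE exE conjE)
    assume R: "\<forall>x::'k. x \<in> \<real> \<and> conjg x = x"
    have "of_real (g (s c x)) = c * of_real (g x)" for c x
    proof -
      obtain r where c: "c = of_real r" using R by (meson Reals_cases)
      show ?thesis by (simp add: c K_Banach_of_real linear_cmul[OF g(1)])
    qed
    then show ?thesis
      using linear_add[OF g(1)] by (intro exI[of _ "\<lambda>x. of_real (g x)"]) (auto simp: conjg_of_real)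
  next
    fix i :: 'k
    assume ii: "i * i = - 1" and ci: "conjg i = - i" and ab: "\<forall>x. \<exists>a b. x = of_real a + of_real b * i"
    define h where "h x = of_real (g x) - i * of_real (g (s i x))" for x
    have add: "h (x + z) = h x + h z" for x z
      by (simp add: h_def linear_add[OF g(1)] scale_right_distrib algebra_simps)
    have hr: "h (r *\<^sub>R x) = of_real r * h x" for r x
      by (simp add: h_def linear_cmul[OF g(1)] K_Banach_scaleR algebra_simps)
    have sii: "s i (s i x) = - x" for x
      by (simp add: ii)
    have hi: "h (s i x) = i * h x" for x
    proof -
      have "i * h x = i * of_real (g x) - (i * i) * of_real (g (s i x))"
        by (simp add: h_def algebra_simps)
      also have "\<dots> = h (s i x)"
        by (simp add: h_def sii linear_neg[OF g(1)] ii)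
      finally show ?thesis by simp
    qed
    have "h (s c x) = c * h x" for c x
    proof -
      obtain a b where c: "c = of_real a + of_real b * i" using ab by blast
      have "s c x = a *\<^sub>R x + b *\<^sub>R s i x"
        by (simp add: c scale_left_distrib K_Banach_of_real flip: scale_scale)
      then show ?thesis by (simp add: add hr hi c algebra_simps)
    qed
    moreover have "h x + conjg (h x) = of_real (2 * g x)" for x
    proof -
      have "conjg (h x) = of_real (g x) + i * of_real (g (s i x))"
        using conjg_add[of "of_real (g x)" "- (i * of_real (g (s i x)))"]
        by (simp add: h_def conjg_of_real conjg_minus conjg_mult ci)
      then show ?thesis by (simp add: h_def)
    qed
    ultimately show ?thesis using add by blast
  qed
  then obtain h where h: "\<And>x z. h (x + z) = h x + h z" "\<And>c x. h (s c x) = c * h x"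
    and re: "\<And>x. h x + conjg (h x) = of_real (2 * g x)" by blast
  \<comment> \<open>Rotating \<open>x\<close> by a unimodular scalar makes \<open>h x\<close> real, where it agrees with \<open>g\<close>.\<close>
  have hn: "norm (h x) \<le> norm x" for x
  proof (cases "h x = 0")
    case False
    define c where "c = conjg (h x) / of_real (norm (h x))"
    have "h (s c x) = of_real (norm (h x))"
      using False mult_conjg[of "h x"]
      by (simp add: h(2) c_def mult.commute power2_eq_square)
    then have "of_real (2 * norm (h x)) = (of_real (2 * g (s c x)) :: 'k)"
      using re[of "s c x"] by (simp add: conjg_of_real)
    then have "norm (h x) = g (s c x)" unfolding of_real_eq_iff by simp
    also have "\<dots> \<le> norm (s c x)" by (rule g(2))
    also have "norm c = 1" using False by (simp add: c_def norm_divide)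
    then have "norm (s c x) = norm x" by (simp add: K_Banach_norm)
    finally show ?thesis .
  qed simp
  have "bounded_linear h"
    using hn h(2)[of "of_real _"]
    by (intro bounded_linear_intro[of _ 1]) (auto simp: h(1) K_Banach_of_real scaleR_conv_of_real)
  then have app: "blinfun_apply (Blinfun h) = h" by (rule bounded_linear_Blinfun_apply)
  have "norm (of_real (2 * g y) :: 'k) \<le> norm (h y) + norm (conjg (h y))"
    unfolding re[symmetric] by (rule norm_triangle_ineq)
  then have "norm y \<le> norm (h y)" by (simp add: g(3))
  moreover have "Blinfun h \<in> dual s"
    unfolding dual_def by (simp add: app linear_K_BanachI h)
  ultimately show ?thesis using hn by (intro bexI[of _ "Blinfun h"]) (auto simp: app)
qed

end

section \<open>Hoelder's inequality\<close>

lemma Holder_inequality_sum: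
  fixes a b :: "'i \<Rightarrow> real"
  assumes pq: "p > 1" "q > 1" "1 / p + 1 / q = 1"
    and a: "\<And>i. i \<in> F \<Longrightarrow> a i \<ge> 0" and b: "\<And>i. i \<in> F \<Longrightarrow> b i \<ge> 0"
  shows "(\<Sum>i\<in>F. a i * b i) \<le> (\<Sum>i\<in>F. a i powr p) powr (1/p) * (\<Sum>i\<in>F. b i powr q) powr (1/q)"
proof (cases "finite F")
  case True
  define S T where "S = (\<Sum>i\<in>F. a i powr p)" and "T = (\<Sum>i\<in>F. b i powr q)"
  have ST: "S \<ge> 0" "T \<ge> 0" by (auto simp: S_def T_def intro: sum_nonneg)
  show ?thesis
  proof (cases "S = 0 \<or> T = 0")
    case True
    have "a i * b i = 0" if "i \<in> F" for i
    proof -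
      have "a i powr p = 0 \<or> b i powr q = 0"
        using True that \<open>finite F\<close> unfolding S_def T_def
        by (auto simp: sum_nonneg_eq_0_iff)
      then show ?thesis by auto
    qed
    then have "(\<Sum>i\<in>F. a i * b i) = 0" by (rule sum.neutral[rule_format])
    then show ?thesis by simp
  next
    case False
    \<comment> \<open>Normalising both families to norm one turns the sum of Young's inequalities into
      \<open>1 / p + 1 / q = 1\<close>.\<close>
    define s t where "s = S powr (1/p)" and "t = T powr (1/q)"
    have st: "s > 0" "t > 0" "s powr p = S" "t powr q = T"
      using False ST pq by (auto simp: s_def t_def powr_powr)
    have "(\<Sum>i\<in>F. (a i / s) * (b i / t)) \<le> (\<Sum>i\<in>F. (a i / s) powr p / p + (b i / t) powr q / q)"
      using a b st by (intro sum_mono Youngs_inequality pq) auto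
    also have "\<dots> = (\<Sum>i\<in>F. a i powr p / (S * p) + b i powr q / (T * q))"
      using a b st by (intro sum.cong) (auto simp: powr_divide)
    also have "\<dots> = S / (S * p) + T / (T * q)"
      by (simp add: sum.distrib sum_divide_distrib[symmetric] S_def T_def)
    also have "\<dots> = 1" using False pq by simp
    finally have "(\<Sum>i\<in>F. a i * b i) / (s * t) \<le> 1"
      by (simp add: sum_divide_distrib)
    then show ?thesis using st(1,2) by (simp add: s_def t_def S_def T_def pos_divide_le_eq)
  qed
qed simp

lemma finite_sum_powr_le_infsum:
  assumes "finite F" "F \<subseteq> I" "(\<lambda>i. norm (a i) powr p) summable_on I" "p > 0"
  shows "(\<Sum>i\<in>F. norm (a i) powr p) powr (1/p) \<le> (\<Sum>\<^sub>\<infinity>i\<in>I. norm (a i) powr p) powr (1/p)"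
  using assms by (intro powr_mono2 finite_sum_le_infsum) (auto intro: sum_nonneg)

text \<open>The form of Hoelder's inequality needed below: the coefficients \<open>a\<close> range over a finite set,
while the factor belonging to \<open>b\<close> is the full \<open>l\<^sup>q\<close> norm, which a Bessel bound controls.\<close>
lemma norm_sum_mult_le_Holder:
  fixes a b :: "'i \<Rightarrow> 'k::real_normed_field"
  assumes "p > 1" "q > 1" "1 / p + 1 / q = 1" "finite F" "F \<subseteq> I"
    and "(\<lambda>i. norm (b i) powr q) summable_on I"
    and "(\<Sum>\<^sub>\<infinity>i\<in>I. norm (b i) powr q) powr (1/q) \<le> B"
  shows "norm (\<Sum>i\<in>F. a i * b i) \<le> B * (\<Sum>i\<in>F. norm (a i) powr p) powr (1/p)"
proof -
  have "norm (\<Sum>i\<in>F. a i * b i) \<le> (\<Sum>i\<in>F. norm (a i) * norm (b i))"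
    by (intro sum_norm_le) (simp add: norm_mult)
  also have "\<dots> \<le> (\<Sum>i\<in>F. norm (a i) powr p) powr (1/p) * (\<Sum>i\<in>F. norm (b i) powr q) powr (1/q)"
    by (intro Holder_inequality_sum assms) auto
  also have "\<dots> \<le> (\<Sum>i\<in>F. norm (a i) powr p) powr (1/p) * B"
    using finite_sum_powr_le_infsum[OF assms(4-6)] assms(2,7) by (intro mult_left_mono) auto
  finally show ?thesis by (simp add: mult.commute)
qed

section \<open>Synthesis of \<open>l\<^sup>p\<close> coefficients\<close>

text \<open>Boundedness of the synthesis map \<open>c \<mapsto> (\<Sum>k. c k x k)\<close> from \<open>l\<^sup>p\<close>, tested on finitely supported
coefficients. By duality this is what a Bessel condition with the conjugate exponent gives.
It is used for \<open>\<phi>\<close> in the target space and for \<open>\<psi>\<close> in the dual of the domain alike.\<close>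
definition synthesis_bound ::
    "('k::real_or_complex \<Rightarrow> 'v::banach \<Rightarrow> 'v) \<Rightarrow> real \<Rightarrow> real \<Rightarrow> 'i set \<Rightarrow> ('i \<Rightarrow> 'v) \<Rightarrow> bool" where
  "synthesis_bound s p B I x \<longleftrightarrow> (\<forall>F c. finite F \<longrightarrow> F \<subseteq> I \<longrightarrow>
     norm (\<Sum>k\<in>F. s (c k) (x k)) \<le> B * (\<Sum>k\<in>F. norm (c k) powr p) powr (1/p))"

text \<open>Some functional \<open>\<eta>\<close> of norm at most one attains the norm of a given finite combination;
Hoelder's inequality then estimates \<open>\<Sum>k\<in>F. c k * \<eta> (\<phi> k)\<close> by the Bessel bound at \<open>\<eta>\<close>.\<close>
lemma synthesis_bound_of_Bessel:
  fixes s :: "'k::real_or_complex \<Rightarrow> 'b::banach \<Rightarrow> 'b"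
  assumes pq: "p > 1" "q > 1" "1 / p + 1 / q = 1" and s: "K_Banach s"
    and bessel: "p_Bessel (dual s) scale_dual q B I (\<lambda>k. kappa (\<phi> k))"
  shows "synthesis_bound s p B I \<phi>"
  unfolding synthesis_bound_def
proof (intro allI impI)
  fix F c assume F: "finite F" "F \<subseteq> I"
  let ?y = "\<Sum>k\<in>F. s (c k) (\<phi> k)" and ?N = "(\<Sum>k\<in>F. norm (c k) powr p) powr (1/p)"
  obtain \<eta> where \<eta>: "\<eta> \<in> dual s" "\<And>x. norm (blinfun_apply \<eta> x) \<le> norm x"
    "norm ?y \<le> norm (blinfun_apply \<eta> ?y)"
    using norming_functional[OF s] by blast
  note linear = \<eta>(1)[unfolded dual_def mem_Collect_eq]
  note b = bessel[unfolded p_Bessel_def kappa_def]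
  have "blinfun_apply \<eta> ?y = (\<Sum>k\<in>F. c k * blinfun_apply \<eta> (\<phi> k))"
    using linear by (simp add: blinfun.sum_right Vector_Spaces.linear_iff)
  also have "norm \<dots> \<le> B * norm \<eta> * ?N"
    using b \<eta>(1) by (intro norm_sum_mult_le_Holder[OF pq F]) auto
  also have "\<dots> \<le> B * ?N"
  proof -
    have "norm \<eta> \<le> 1" using \<eta>(2) by (intro norm_blinfun_bound) auto
    moreover have "B > 0" using b by blast
    ultimately show ?thesis by (intro mult_right_mono) auto
  qed
  finally show "norm ?y \<le> B * ?N" using \<eta>(3) by linarith
qed

lemma bounded_linear_scale_dual:
  "bounded_linear (scale_dual c :: ('a::banach \<Rightarrow>\<^sub>L 'k::real_or_complex) \<Rightarrow> _)"
  unfolding scale_dual_def by (intro bounded_linear_intros)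

lemma scale_dual_apply [simp]: "blinfun_apply (scale_dual c g) x = c * blinfun_apply g x"
  by (simp add: scale_dual_def)

lemma K_Banach_scale_dual: "K_Banach (scale_dual :: 'k::real_or_complex \<Rightarrow> ('a::banach \<Rightarrow>\<^sub>L 'k) \<Rightarrow> _)"
  unfolding K_Banach_def
proof (intro conjI allI)
  show "vector_space (scale_dual :: 'k \<Rightarrow> ('a \<Rightarrow>\<^sub>L 'k) \<Rightarrow> _)"
    by standard (auto intro!: blinfun_eqI simp: blinfun.add_left algebra_simps)
next
  fix r and g :: "'a \<Rightarrow>\<^sub>L 'k"
  show "scale_dual (of_real r) g = r *\<^sub>R g"
    by (intro blinfun_eqI) (simp add: blinfun.scaleR_left scaleR_conv_of_real)
next
  fix c and g :: "'a \<Rightarrow>\<^sub>L 'k"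
  have le: "norm (scale_dual c g) \<le> norm c * norm g" for c and g :: "'a \<Rightarrow>\<^sub>L 'k"
    by (intro norm_blinfun_bound)
       (auto simp: norm_mult mult.assoc intro!: mult_left_mono norm_blinfun)
  show "norm (scale_dual c g) = norm c * norm g"
  proof (cases "c = 0")
    case False
    have "g = scale_dual (inverse c) (scale_dual c g)"
      using False by (intro blinfun_eqI) simp
    then have "norm g \<le> inverse (norm c) * norm (scale_dual c g)"
      using le[of "inverse c" "scale_dual c g"] by (simp add: norm_inverse)
    then have "norm c * norm g \<le> norm (scale_dual c g)"
      using False by (simp add: field_simps)
    then show ?thesis using le[of c g] by simp
  qed (use le[of 0 g] in auto)
qed

text \<open>Here the norm of a combination of functionals is by definition tested on vectors \<open>f\<close>, so the
Bessel condition applies to \<open>f\<close> directly.\<close>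
lemma synthesis_bound_of_Bessel_dual:
  fixes \<psi> :: "'i \<Rightarrow> ('a::banach \<Rightarrow>\<^sub>L 'k::real_or_complex)"
  assumes pq: "p > 1" "q > 1" "1 / p + 1 / q = 1"
    and bessel: "p_Bessel UNIV s p B I (\<lambda>k. blinfun_apply (\<psi> k))"
  shows "synthesis_bound scale_dual q B I \<psi>"
  unfolding synthesis_bound_def
proof (intro allI impI norm_blinfun_bound)
  fix F c f assume F: "finite F" "F \<subseteq> I"
  have "1 / q + 1 / p = 1" using pq(3) by simp
  then have "norm (\<Sum>k\<in>F. c k * blinfun_apply (\<psi> k) f)
      \<le> B * norm f * (\<Sum>k\<in>F. norm (c k) powr q) powr (1/q)"
    using bessel[unfolded p_Bessel_def] by (intro norm_sum_mult_le_Holder[OF pq(2,1) _ F]) auto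
  then show "norm (blinfun_apply (\<Sum>k\<in>F. scale_dual (c k) (\<psi> k)) f)
      \<le> B * (\<Sum>k\<in>F. norm (c k) powr q) powr (1/q) * norm f"
    by (simp add: blinfun.sum_left mult_ac)
next
  show "0 \<le> B * (\<Sum>k\<in>F. norm (c k) powr q) powr (1/q)" for F and c :: "'i \<Rightarrow> 'k"
    using bessel by (auto simp: p_Bessel_def)
qed

text \<open>Cauchy's criterion for unconditional sums. Absolute summability would be too strong a
requirement here: synthesis of \<open>l\<^sup>p\<close> coefficients need not converge absolutely.\<close>
lemma summable_on_Cauchy_tailsI:
  fixes f :: "'i \<Rightarrow> 'v::banach"
  assumes tails: "\<And>e. e > 0 \<Longrightarrow> \<exists>F0. finite F0 \<and> F0 \<subseteq> I \<and>
    (\<forall>F. finite F \<longrightarrow> F \<subseteq> I - F0 \<longrightarrow> norm (sum f F) \<le> e)"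
  shows "f summable_on I"
proof -
  have "\<exists>P. eventually P (finite_subsets_at_top I) \<and>
          (\<forall>F F'. P F \<and> P F' \<longrightarrow> dist (sum f F) (sum f F') < e)" if "e > 0" for e
  proof -
    obtain F0 where F0: "finite F0" "F0 \<subseteq> I"
      and small: "\<And>F. finite F \<Longrightarrow> F \<subseteq> I - F0 \<Longrightarrow> norm (sum f F) \<le> e / 3"
      using tails[of "e / 3"] \<open>e > 0\<close> by auto
    define P where "P F \<longleftrightarrow> finite F \<and> F0 \<subseteq> F \<and> F \<subseteq> I" for F
    have "eventually P (finite_subsets_at_top I)"
      unfolding eventually_finite_subsets_at_top P_def using F0 by auto
    moreover have "dist (sum f F) (sum f F') < e" if "P F" "P F'" for F F'
    proof -
      have near: "dist (sum f F) (sum f F0) \<le> e / 3" if "P F" for F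
      proof -
        have "sum f F - sum f F0 = sum f (F - F0)"
          using that F0 by (intro sum_diff[symmetric]) (auto simp: P_def)
        then show ?thesis
          using small[of "F - F0"] that unfolding dist_norm P_def by auto
      qed
      show ?thesis
        using near[OF that(1)] near[OF that(2)] dist_triangle2[of "sum f F" "sum f F'" "sum f F0"]
          \<open>e > 0\<close> by linarith
    qed
    ultimately show ?thesis by blast
  qed
  then have "cauchy_filter (filtermap (sum f) (finite_subsets_at_top I))"
    by (simp add: cauchy_filter_metric_filtermap)
  moreover have "complete (UNIV :: 'v set)"
    by (meson Cauchy_convergent UNIV_I complete_def convergent_def)
  ultimately obtain L where "(sum f \<longlongrightarrow> L) (finite_subsets_at_top I)"
    using complete_uniform[where S=UNIV] by (force simp add: filterlim_def)
  then show ?thesis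
    using summable_on_def has_sum_def by blast
qed

text \<open>The synthesis bound applied to a finite set \<open>F\<close> outside a large finite set controls the partial
sum over \<open>F\<close> by a tail of the convergent series \<open>\<Sum> \<bar>c k\<bar>\<^sup>p\<close>.\<close>
lemma synthesis_summable:
  assumes syn: "synthesis_bound s p B I x" and pos: "p > 0" "B > 0"
    and c: "(\<lambda>k. norm (c k) powr p) summable_on I"
  shows "(\<lambda>k. s (c k) (x k)) summable_on I"
proof (rule summable_on_Cauchy_tailsI)
  fix e :: real assume "e > 0"
  \<comment> \<open>A tail of size \<open>d\<close> gives partial sums of norm at most \<open>B * d powr (1/p) = e\<close>.\<close>
  define d where "d = (e / B) powr p"
  have d: "d > 0" "B * d powr (1/p) = e"
    using \<open>e > 0\<close> pos by (auto simp: d_def powr_powr)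
  let ?n = "\<lambda>k. norm (c k) powr p"
  obtain F0 where F0: "finite F0" "F0 \<subseteq> I" "dist (sum ?n F0) (infsum ?n I) \<le> d"
    using infsum_finite_approximation[OF c d(1)] by blast
  have "norm (\<Sum>k\<in>F. s (c k) (x k)) \<le> e" if F: "finite F" "F \<subseteq> I - F0" for F
  proof -
    have "sum ?n F + sum ?n F0 = sum ?n (F \<union> F0)"
      using F F0 by (intro sum.union_disjoint[symmetric]) auto
    also have "\<dots> \<le> infsum ?n I"
      using F F0 by (intro finite_sum_le_infsum c) auto
    finally have "sum ?n F \<le> d" using F0(3) by (simp add: dist_real_def)
    then have "B * sum ?n F powr (1/p) \<le> B * d powr (1/p)"
      using pos by (intro mult_left_mono powr_mono2) (auto intro: sum_nonneg)
    moreover have "norm (\<Sum>k\<in>F. s (c k) (x k)) \<le> B * sum ?n F powr (1/p)"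
      using syn F unfolding synthesis_bound_def by blast
    ultimately show ?thesis using d(2) by linarith
  qed
  then show "\<exists>F0. finite F0 \<and> F0 \<subseteq> I \<and>
      (\<forall>F. finite F \<longrightarrow> F \<subseteq> I - F0 \<longrightarrow> norm (\<Sum>k\<in>F. s (c k) (x k)) \<le> e)"
    using F0 by blast
qed

lemma norm_synthesis_le:
  assumes syn: "synthesis_bound s p B I x" and pos: "p > 0" "B > 0"
    and c: "(\<lambda>k. norm (c k) powr p) summable_on I"
  shows "norm (\<Sum>\<^sub>\<infinity>k\<in>I. s (c k) (x k)) \<le> B * (\<Sum>\<^sub>\<infinity>k\<in>I. norm (c k) powr p) powr (1/p)"
proof (rule tendsto_upperbound[OF _ _ finite_subsets_at_top_neq_bot])
  show "((\<lambda>F. norm (\<Sum>k\<in>F. s (c k) (x k))) \<longlongrightarrow> norm (\<Sum>\<^sub>\<infinity>k\<in>I. s (c k) (x k)))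
      (finite_subsets_at_top I)"
    by (intro tendsto_norm infsum_tendsto synthesis_summable[OF assms])
  have "norm (\<Sum>k\<in>F. s (c k) (x k)) \<le> B * (\<Sum>\<^sub>\<infinity>k\<in>I. norm (c k) powr p) powr (1/p)"
    if "finite F" "F \<subseteq> I" for F
  proof -
    have "norm (\<Sum>k\<in>F. s (c k) (x k)) \<le> B * (\<Sum>k\<in>F. norm (c k) powr p) powr (1/p)"
      using syn that unfolding synthesis_bound_def by blast
    also have "\<dots> \<le> B * (\<Sum>\<^sub>\<infinity>k\<in>I. norm (c k) powr p) powr (1/p)"
      using that pos by (intro mult_left_mono finite_sum_powr_le_infsum c) auto
    finally show ?thesis .
  qed
  then show "\<forall>\<^sub>F F in finite_subsets_at_top I. norm (\<Sum>k\<in>F. s (c k) (x k))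
      \<le> B * (\<Sum>\<^sub>\<infinity>k\<in>I. norm (c k) powr p) powr (1/p)"
    by (intro eventually_finite_subsets_at_top_weakI)
qed

lemma bounded_times_lp:
  fixes m a :: "'i \<Rightarrow> 'k::real_normed_field"
  assumes "p > 0" and m: "\<And>k. k \<in> I \<Longrightarrow> norm (m k) \<le> C" and "C \<ge> 0"
    and a: "(\<lambda>k. norm (a k) powr p) summable_on I"
  shows "(\<lambda>k. norm (m k * a k) powr p) summable_on I"
    and "(\<Sum>\<^sub>\<infinity>k\<in>I. norm (m k * a k) powr p) powr (1/p)
       \<le> C * (\<Sum>\<^sub>\<infinity>k\<in>I. norm (a k) powr p) powr (1/p)"
proof -
  have le: "norm (m k * a k) powr p \<le> C powr p * norm (a k) powr p" if "k \<in> I" for k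
    using m[OF that] assms(1,3)
    by (auto simp: norm_mult powr_mult[symmetric] intro!: powr_mono2 mult_right_mono)
  have R: "(\<lambda>k. C powr p * norm (a k) powr p) summable_on I"
    by (intro summable_on_cmult_right a)
  show S: "(\<lambda>k. norm (m k * a k) powr p) summable_on I"
    by (rule summable_on_comparison_test[OF R]) (use le in auto)
  have "(\<Sum>\<^sub>\<infinity>k\<in>I. norm (m k * a k) powr p) \<le> C powr p * (\<Sum>\<^sub>\<infinity>k\<in>I. norm (a k) powr p)"
    using infsum_mono[OF S R le] by (simp add: infsum_cmult_right')
  then have "(\<Sum>\<^sub>\<infinity>k\<in>I. norm (m k * a k) powr p) powr (1/p)
      \<le> (C powr p * (\<Sum>\<^sub>\<infinity>k\<in>I. norm (a k) powr p)) powr (1/p)"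
    using assms(1) by (intro powr_mono2) (auto intro: infsum_nonneg)
  also have "\<dots> = C * (\<Sum>\<^sub>\<infinity>k\<in>I. norm (a k) powr p) powr (1/p)"
    using assms(1,3) by (simp add: powr_mult powr_powr infsum_nonneg)
  finally show "(\<Sum>\<^sub>\<infinity>k\<in>I. norm (m k * a k) powr p) powr (1/p)
       \<le> C * (\<Sum>\<^sub>\<infinity>k\<in>I. norm (a k) powr p) powr (1/p)" .
qed

text \<open>The three factors of a multiplier: analysis by the \<open>p\<close>-Bessel sequence \<open>g\<close>, with constant
\<open>A\<close>; pointwise multiplication by \<open>m\<close> on \<open>l\<^sup>p\<close>, with constant \<open>C\<close>; synthesis, with constant \<open>B\<close>.
Besides the multiplier and its adjoint, this is applied to truncations of the symbol, where a
small \<open>C\<close> makes the operator small.\<close>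
lemma multiplier_summable_and_bound:
  fixes g :: "'i \<Rightarrow> 'a::real_normed_vector \<Rightarrow> 'k::real_or_complex"
  assumes syn: "synthesis_bound s p B I x" and "p > 0" "B > 0"
    and bessel: "p_Bessel S t p A I g" and "f \<in> S"
    and m: "\<And>k. k \<in> I \<Longrightarrow> norm (m k) \<le> C" and C: "C \<ge> 0"
  shows "(\<lambda>k. s (m k * g k f) (x k)) summable_on I"
    and "norm (\<Sum>\<^sub>\<infinity>k\<in>I. s (m k * g k f) (x k)) \<le> B * A * C * norm f"
proof -
  have g: "(\<lambda>k. norm (g k f) powr p) summable_on I"
    "(\<Sum>\<^sub>\<infinity>k\<in>I. norm (g k f) powr p) powr (1/p) \<le> A * norm f"
    using bessel \<open>f \<in> S\<close> by (auto simp: p_Bessel_def)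
  have mg: "(\<lambda>k. norm (m k * g k f) powr p) summable_on I"
    "(\<Sum>\<^sub>\<infinity>k\<in>I. norm (m k * g k f) powr p) powr (1/p)
       \<le> C * (\<Sum>\<^sub>\<infinity>k\<in>I. norm (g k f) powr p) powr (1/p)"
    by (rule bounded_times_lp[OF assms(2) m C g(1)]; assumption)+
  show "(\<lambda>k. s (m k * g k f) (x k)) summable_on I"
    by (rule synthesis_summable[OF assms(1-3) mg(1)])
  have "norm (\<Sum>\<^sub>\<infinity>k\<in>I. s (m k * g k f) (x k))
      \<le> B * (\<Sum>\<^sub>\<infinity>k\<in>I. norm (m k * g k f) powr p) powr (1/p)"
    by (rule norm_synthesis_le[OF assms(1-3) mg(1)])
  also have "\<dots> \<le> B * (C * (A * norm f))"
    using mg(2) mult_left_mono[OF g(2) C] assms(3) by (intro mult_left_mono) auto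
  finally show "norm (\<Sum>\<^sub>\<infinity>k\<in>I. s (m k * g k f) (x k)) \<le> B * A * C * norm f"
    by (simp add: mult_ac)
qed

section \<open>Multipliers\<close>

lemma norm_le_linf_norm: "m \<in> linf I \<Longrightarrow> k \<in> I \<Longrightarrow> norm (m k) \<le> linf_norm I m"
  and linf_norm_nonneg: "m \<in> linf I \<Longrightarrow> 0 \<le> linf_norm I m"
proof -
  assume "m \<in> linf I"
  then obtain R where "\<forall>k\<in>I. norm (m k) \<le> R" by (auto simp: linf_def bounded_iff)
  then have bdd: "bdd_above (insert 0 ((\<lambda>k. norm (m k)) ` I))" by auto
  then show "0 \<le> linf_norm I m" unfolding linf_norm_def by (intro cSup_upper) auto
  show "norm (m k) \<le> linf_norm I m" if "k \<in> I"
    unfolding linf_norm_def using bdd that by (intro cSup_upper) auto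
qed

lemma linear_multiplier:
  fixes s\<^sub>1 :: "'k::real_or_complex \<Rightarrow> 'a::banach \<Rightarrow> 'a" and s\<^sub>2 :: "'k \<Rightarrow> 'b::banach \<Rightarrow> 'b"
  assumes "K_Banach s\<^sub>1" "K_Banach s\<^sub>2" and \<psi>: "\<And>k. k \<in> I \<Longrightarrow> \<psi> k \<in> dual s\<^sub>1"
    and M: "\<And>f. ((\<lambda>k. s\<^sub>2 (m k * blinfun_apply (\<psi> k) f) (\<phi> k)) has_sum M f) I"
  shows "Vector_Spaces.linear s\<^sub>1 s\<^sub>2 M"
proof -
  interpret s2: vector_space s\<^sub>2 by (rule K_Banach_vector_space) fact
  have "M (f + g) = M f + M g" for f g
    by (rule has_sum_unique[OF M])
       (use has_sum_add[OF M[of f] M[of g]] in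
         \<open>simp add: blinfun.add_right distrib_left s2.scale_left_distrib\<close>)
  moreover have "M (s\<^sub>1 c f) = s\<^sub>2 c (M f)" for c f
  proof (rule has_sum_unique[OF M])
    have "((\<lambda>k. s\<^sub>2 c (s\<^sub>2 (m k * blinfun_apply (\<psi> k) f) (\<phi> k))) has_sum s\<^sub>2 c (M f)) I"
      by (rule has_sum_bounded_linear[OF bounded_linear_K_Banach_right[OF assms(2)] M])
    moreover have "blinfun_apply (\<psi> k) (s\<^sub>1 c f) = c * blinfun_apply (\<psi> k) f" if "k \<in> I" for k
      using \<psi>[OF that] by (simp add: dual_def Vector_Spaces.linear_iff)
    ultimately show "((\<lambda>k. s\<^sub>2 (m k * blinfun_apply (\<psi> k) (s\<^sub>1 c f)) (\<phi> k)) has_sum s\<^sub>2 c (M f)) I"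
      by (simp add: mult.left_commute cong: has_sum_cong)
  qed
  ultimately show ?thesis
    using K_Banach_vector_space[OF assms(1)] s2.vector_space_axioms
    by (auto simp: Vector_Spaces.linear_iff)
qed

lemma bounded_linear_of_K_linear:
  assumes "K_Banach s\<^sub>1" "K_Banach s\<^sub>2" "Vector_Spaces.linear s\<^sub>1 s\<^sub>2 T"
    and "\<And>x. norm (T x) \<le> C * norm x"
  shows "bounded_linear T"
proof (rule bounded_linear_intro)
  show "T (r *\<^sub>R x) = r *\<^sub>R T x" for r x
    using assms(3) K_Banach_of_real[OF assms(1)] K_Banach_of_real[OF assms(2)]
    by (metis Vector_Spaces.linear_iff)
qed (use assms(3,4) in \<open>auto simp: Vector_Spaces.linear_iff mult.commute\<close>)

section \<open>Adjoints\<close>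

lemma dual_adjoint_apply:
  "bounded_linear T \<Longrightarrow> blinfun_apply (dual_adjoint T \<eta>) x = blinfun_apply \<eta> (T x)"
  unfolding dual_adjoint_def
  by (subst bounded_linear_Blinfun_apply) (auto intro: bounded_linear_intros)

lemma conj_functional_apply [simp]:
  "blinfun_apply (conj_functional g) x = conjg (blinfun_apply g x)"
  unfolding conj_functional_def
  by (subst bounded_linear_Blinfun_apply)
     (auto intro: bounded_linear_compose[OF bounded_linear_conjg blinfun.bounded_linear_right])

lemma scale_dual_scale_dual: "scale_dual a (scale_dual b g) = scale_dual (a * b) g"
  by (intro blinfun_eqI) simp

lemma bounded_linear_conj_functional: "bounded_linear conj_functional"
  by (intro bounded_linear_intro[of _ 1] blinfun_eqI norm_blinfun_bound)
     (auto simp: blinfun.add_left blinfun.scaleR_left conjg_add norm_blinfun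
       linear_cmul[OF bounded_linear.linear[OF bounded_linear_conjg]])

lemma conj_functional_antidual:
  assumes "K_Banach s" "\<eta> \<in> antidual s"
  shows "conj_functional \<eta> \<in> dual s"
  using assms unfolding dual_def antidual_def
  by (auto intro!: linear_K_BanachI simp: blinfun.add_right conjg_add conjg_mult)

text \<open>The series of functionals converges in norm by the hypothesis \<open>sum\<close>, so its limit can be
identified pointwise: at \<open>f\<close> both sides are the sum of \<open>m k * \<eta> (\<phi> k) * \<psi> k f\<close>, which for
the adjoint comes from applying \<open>\<eta>\<close> to the series for \<open>M f\<close>.\<close>
lemma has_sum_adjoint:
  fixes s :: "'k::real_or_complex \<Rightarrow> 'b::banach \<Rightarrow> 'b" and \<psi> :: "'i \<Rightarrow> ('a::banach \<Rightarrow>\<^sub>L 'k)"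
  assumes "bounded_linear M" and \<eta>: "\<eta> \<in> dual s"
    and M: "\<And>f. ((\<lambda>k. s (m k * blinfun_apply (\<psi> k) f) (\<phi> k)) has_sum M f) I"
    and sum: "(\<lambda>k. scale_dual (m k * kappa (\<phi> k) \<eta>) (\<psi> k)) summable_on I"
  shows "((\<lambda>k. scale_dual (m k) (tensor scale_dual (\<psi> k) (kappa (\<phi> k)) \<eta>))
    has_sum dual_adjoint M \<eta>) I"
proof -
  obtain X where X: "((\<lambda>k. scale_dual (m k * kappa (\<phi> k) \<eta>) (\<psi> k)) has_sum X) I"
    using sum by (auto simp: summable_on_def)
  have "X = dual_adjoint M \<eta>"
  proof (rule blinfun_eqI, rule has_sum_unique)
    fix f
    show "((\<lambda>k. m k * blinfun_apply \<eta> (\<phi> k) * blinfun_apply (\<psi> k) f) has_sum blinfun_apply X f) I"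
      using has_sum_bounded_linear[OF blinfun.bounded_linear_left[of f] X] by (simp add: kappa_def)
    have "blinfun_apply \<eta> (s c y) = c * blinfun_apply \<eta> y" for c y
      using \<eta> by (simp add: dual_def Vector_Spaces.linear_iff)
    then show "((\<lambda>k. m k * blinfun_apply \<eta> (\<phi> k) * blinfun_apply (\<psi> k) f)
        has_sum blinfun_apply (dual_adjoint M \<eta>) f) I"
      using has_sum_bounded_linear[OF blinfun.bounded_linear_right[of \<eta>] M[of f]]
      by (simp add: dual_adjoint_apply[OF assms(1)] mult_ac)
  qed
  then show ?thesis using X by (simp add: tensor_def scale_dual_scale_dual)
qed

text \<open>Conjugation is a bounded real-linear map on functionals, so it carries the convergent series for
the linear functional \<open>conj_functional \<eta>\<close> to the one for \<open>\<eta>\<close>; the conjugates on the symbol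
arise because each scalar passes through this map.\<close>
lemma has_sum_adjoint_antidual:
  fixes \<psi> :: "'i \<Rightarrow> ('a::banach \<Rightarrow>\<^sub>L 'k::real_or_complex)"
  assumes "bounded_linear M"
    and sum: "((\<lambda>k. scale_dual (m k) (tensor scale_dual (\<psi> k) (kappa (\<phi> k)) (conj_functional \<eta>)))
      has_sum dual_adjoint M (conj_functional \<eta>)) I"
  shows "((\<lambda>k. scale_dual (conjg (m k))
      (tensor scale_dual (conj_functional (\<psi> k)) (kappa (\<phi> k)) \<eta>)) has_sum dual_adjoint M \<eta>) I"
proof -
  have "conj_functional (dual_adjoint M (conj_functional \<eta>)) = dual_adjoint M \<eta>"
    by (intro blinfun_eqI) (simp add: dual_adjoint_apply[OF assms(1)])
  moreover have "conj_functional (scale_dual (m k)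
        (tensor scale_dual (\<psi> k) (kappa (\<phi> k)) (conj_functional \<eta>)))
      = scale_dual (conjg (m k)) (tensor scale_dual (conj_functional (\<psi> k)) (kappa (\<phi> k)) \<eta>)" for k
    by (intro blinfun_eqI) (simp add: tensor_def kappa_def conjg_mult)
  ultimately show ?thesis
    using has_sum_bounded_linear[OF bounded_linear_conj_functional sum] by simp
qed

section \<open>Compactness\<close>

lemma finite_large_of_c0:
  assumes "m \<in> c0 I" "d > 0"
  shows "finite {k\<in>I. norm (m k) \<ge> d}"
proof -
  have "\<forall>\<^sub>F k in inf cofinite (principal I). dist (m k) 0 < d"
    using assms tendstoD unfolding c0_def by blast
  then have "finite {k. \<not> (k \<in> I \<longrightarrow> norm (m k) < d)}"
    by (simp add: eventually_inf_principal eventually_cofinite)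
  then show ?thesis by (rule rev_finite_subset) auto
qed

text \<open>A set within every positive distance of some compact set is totally bounded. This is the
reason why operator-norm limits of finite-rank operators are compact.\<close>
lemma compact_closure_if_near_compact:
  fixes S :: "'b::banach set"
  assumes near: "\<And>e. e > 0 \<Longrightarrow> \<exists>K. compact K \<and> (\<forall>x\<in>S. \<exists>y\<in>K. dist x y \<le> e)"
  shows "compact (closure S)"
  unfolding compact_eq_totally_bounded
proof (intro conjI allI impI)
  show "complete (closure S)" by (simp add: complete_eq_closed)
  fix e :: real assume "e > 0"
  then obtain K where K: "compact K" "\<And>x. x \<in> S \<Longrightarrow> \<exists>y\<in>K. dist x y \<le> e / 4"
    using near[of "e / 4"] by auto
  then obtain T where T: "finite T" "K \<subseteq> (\<Union>x\<in>T. ball x (e / 4))"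
    using \<open>e > 0\<close> unfolding compact_eq_totally_bounded by (metis divide_pos_pos zero_less_numeral)
  have "closure S \<subseteq> (\<Union>x\<in>T. ball x e)"
  proof
    fix x assume "x \<in> closure S"
    then obtain z where z: "z \<in> S" "dist z x < e / 4"
      using \<open>e > 0\<close> closure_approachable by (metis divide_pos_pos zero_less_numeral)
    obtain y where y: "y \<in> K" "dist z y \<le> e / 4" using K(2) z(1) by blast
    obtain t where t: "t \<in> T" "dist t y < e / 4" using T(2) y(1) by auto
    have "dist t x \<le> dist t y + dist z y + dist z x"
      by (smt (verit) dist_commute dist_triangle)
    then have "dist t x < e" using z y t \<open>e > 0\<close> by linarith
    then show "x \<in> (\<Union>x\<in>T. ball x e)" using t(1) by auto
  qed
  then show "\<exists>k. finite k \<and> closure S \<subseteq> (\<Union>x\<in>k. ball x e)" using T(1) by blast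
qed

text \<open>Finite-rank operators map bounded sets into sets of this form. Compactness comes from the
Heine-Borel property of the scalar field alone, by adding one continuous image of a ball at a time.\<close>
lemma compact_finite_combinations:
  fixes s :: "'k::real_or_complex \<Rightarrow> 'b::banach \<Rightarrow> 'b"
  assumes "K_Banach s" "finite F"
  shows "compact {\<Sum>k\<in>F. s (c k) (x k) |c. \<forall>k\<in>F. norm (c k) \<le> r k}"
  using assms(2)
proof induction
  case empty
  have "{\<Sum>k\<in>{}. s (c k) (x k) |c. \<forall>k\<in>{}. norm (c k) \<le> r k} = {0}" by auto
  then show ?case by simp
next
  case (insert j F)
  let ?K = "\<lambda>F. {\<Sum>k\<in>F. s (c k) (x k) |c. \<forall>k\<in>F. norm (c k) \<le> r k}"
  have "compact ((\<lambda>a. s a (x j)) ` cball 0 (r j))"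
    by (intro compact_continuous_image linear_continuous_on bounded_linear_K_Banach_left assms)
       auto
  then have "compact {u + v |u v. u \<in> (\<lambda>a. s a (x j)) ` cball 0 (r j) \<and> v \<in> ?K F}"
    by (intro compact_sums insert.IH)
  also have "{u + v |u v. u \<in> (\<lambda>a. s a (x j)) ` cball 0 (r j) \<and> v \<in> ?K F} = ?K (insert j F)"
  proof (intro equalityI subsetI)
    fix w assume "w \<in> {u + v |u v. u \<in> (\<lambda>a. s a (x j)) ` cball 0 (r j) \<and> v \<in> ?K F}"
    then obtain a c where w: "w = s a (x j) + (\<Sum>k\<in>F. s (c k) (x k))"
      and bd: "norm a \<le> r j" "\<forall>k\<in>F. norm (c k) \<le> r k" by auto
    have "w = (\<Sum>k\<in>insert j F. s ((c(j := a)) k) (x k))"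
      using insert.hyps by (auto simp: w intro!: sum.cong)
    then show "w \<in> ?K (insert j F)" using bd by (auto intro!: exI[of _ "c(j := a)"])
  next
    fix w assume "w \<in> ?K (insert j F)"
    then obtain c where "w = (\<Sum>k\<in>insert j F. s (c k) (x k))" "\<forall>k\<in>insert j F. norm (c k) \<le> r k"
      by auto
    then show "w \<in> {u + v |u v. u \<in> (\<lambda>a. s a (x j)) ` cball 0 (r j) \<and> v \<in> ?K F}"
      using insert.hyps by force
  qed
  finally show ?case .
qed

(* The five conjuncts of the conclusion: (1); the adjoint in (2) for linear functionals and
   arbitrary scalars, where no conjugate arises; (2) with conjugates for linear functionals, true
   for real symbols (so always when the scalar field is real); (2) with conjugates for arbitrary
   scalars, on conjugate-linear functionals; (3). *)
theorem theorem2p7: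
  fixes p q B\<^sub>1 B\<^sub>2 :: real
    and I :: "'i set"
    and s\<^sub>1 :: "'k::real_or_complex \<Rightarrow> 'a::banach \<Rightarrow> 'a"
    and s\<^sub>2 :: "'k \<Rightarrow> 'b::banach \<Rightarrow> 'b"
    and \<psi> :: "'i \<Rightarrow> ('a \<Rightarrow>\<^sub>L 'k)"
    and \<phi> :: "'i \<Rightarrow> 'b"
    and m :: "'i \<Rightarrow> 'k"
    and M :: "'a \<Rightarrow> 'b"
  assumes "p > 0" "q > 0" "1 / p + 1 / q = 1"
    and "K_Banach s\<^sub>1" "separable_space (euclidean :: 'a topology)" "reflexive s\<^sub>1"
    and "K_Banach s\<^sub>2" "separable_space (euclidean :: 'b topology)" "reflexive s\<^sub>2"
    and "\<psi> ` I \<subseteq> dual s\<^sub>1"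
    and "p_Bessel UNIV s\<^sub>1 p B\<^sub>1 I (\<lambda>k. blinfun_apply (\<psi> k))"
    and "p_Bessel (dual s\<^sub>2) scale_dual q B\<^sub>2 I (\<lambda>k. kappa (\<phi> k))"
    and "m \<in> linf I"
  defines "M \<equiv> multiplier s\<^sub>2 I m \<phi> (\<lambda>k. blinfun_apply (\<psi> k))"
  shows
    "((\<forall>f. (\<lambda>k. s\<^sub>2 (m k * blinfun_apply (\<psi> k) f) (\<phi> k)) summable_on I) \<and>
      Vector_Spaces.linear s\<^sub>1 s\<^sub>2 M \<and> bounded_linear M \<and>
      onorm M \<le> B\<^sub>2 * B\<^sub>1 * linf_norm I m) \<and>
     (\<forall>\<eta>\<in>dual s\<^sub>2.
       ((\<lambda>k. scale_dual (m k) (tensor scale_dual (\<psi> k) (kappa (\<phi> k)) \<eta>))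
          has_sum dual_adjoint M \<eta>) I \<and>
       dual_adjoint M \<eta> = multiplier scale_dual I m \<psi> (\<lambda>k. kappa (\<phi> k)) \<eta>) \<and>
     ((\<forall>k\<in>I. m k \<in> \<real>) \<longrightarrow> (\<forall>\<eta>\<in>dual s\<^sub>2.
       ((\<lambda>k. scale_dual (conjg (m k)) (tensor scale_dual (\<psi> k) (kappa (\<phi> k)) \<eta>))
          has_sum dual_adjoint M \<eta>) I \<and>
       dual_adjoint M \<eta> =
         multiplier scale_dual I (\<lambda>k. conjg (m k)) \<psi> (\<lambda>k. kappa (\<phi> k)) \<eta>)) \<and>
     (\<forall>\<eta>\<in>antidual s\<^sub>2.
       ((\<lambda>k. scale_dual (conjg (m k))
               (tensor scale_dual (conj_functional (\<psi> k)) (kappa (\<phi> k)) \<eta>))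
          has_sum dual_adjoint M \<eta>) I \<and>
       dual_adjoint M \<eta> =
         multiplier scale_dual I (\<lambda>k. conjg (m k)) (\<lambda>k. conj_functional (\<psi> k))
           (\<lambda>k. kappa (\<phi> k)) \<eta>) \<and>
     (m \<in> c0 I \<longrightarrow> compact_operator M)"
proof -
  have "1 / p < 1" "1 / q < 1" using assms(1-3) by (smt (verit) divide_pos_pos)+
  then have p1: "p > 1" and q1: "q > 1" using assms(1,2) by auto
  define C where "C = linf_norm I m"
  have C: "C \<ge> 0" "\<And>k. k \<in> I \<Longrightarrow> norm (m k) \<le> C"
    using linf_norm_nonneg[OF assms(13)] norm_le_linf_norm[OF assms(13)] by (auto simp: C_def)
  have B: "B\<^sub>1 > 0" "B\<^sub>2 > 0" using assms(11,12) by (auto simp: p_Bessel_def)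
  have dual1: "\<psi> k \<in> dual s\<^sub>1" if "k \<in> I" for k using assms(10) that by blast
  have syn: "synthesis_bound s\<^sub>2 p B\<^sub>2 I \<phi>"
    by (rule synthesis_bound_of_Bessel[OF p1 q1 assms(3,7,12)])
  have syn': "synthesis_bound scale_dual q B\<^sub>1 I \<psi>"
    by (rule synthesis_bound_of_Bessel_dual[OF p1 q1 assms(3,11)])
  note conv = multiplier_summable_and_bound[OF syn assms(1) B(2) assms(11) UNIV_I]
  have sum: "(\<lambda>k. s\<^sub>2 (m k * blinfun_apply (\<psi> k) f) (\<phi> k)) summable_on I" for f
    by (rule conv(1)[OF C(2,1)])
  have bound: "norm (M f) \<le> B\<^sub>2 * B\<^sub>1 * C * norm f" for f
    unfolding M_def multiplier_def by (rule conv(2)[OF C(2,1)])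
  have M: "((\<lambda>k. s\<^sub>2 (m k * blinfun_apply (\<psi> k) f) (\<phi> k)) has_sum M f) I" for f
    unfolding M_def multiplier_def by (rule has_sum_infsum[OF sum])
  have lin: "Vector_Spaces.linear s\<^sub>1 s\<^sub>2 M"
    by (rule linear_multiplier[OF assms(4,7) dual1 M])
  have bl: "bounded_linear M"
    by (rule bounded_linear_of_K_linear[OF assms(4,7) lin bound])
  have onorm: "onorm M \<le> B\<^sub>2 * B\<^sub>1 * linf_norm I m"
    using bound B C(1) by (intro onorm_bound) (auto simp: C_def)
  have adj: "((\<lambda>k. scale_dual (m k) (tensor scale_dual (\<psi> k) (kappa (\<phi> k)) \<eta>))
      has_sum dual_adjoint M \<eta>) I" if "\<eta> \<in> dual s\<^sub>2" for \<eta>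
  proof (rule has_sum_adjoint[OF bl that M])
    show "(\<lambda>k. scale_dual (m k * kappa (\<phi> k) \<eta>) (\<psi> k)) summable_on I"
      by (rule multiplier_summable_and_bound(1)[OF syn' assms(2) B(1) assms(12) that C(2,1)])
  qed
  have anti: "((\<lambda>k. scale_dual (conjg (m k))
      (tensor scale_dual (conj_functional (\<psi> k)) (kappa (\<phi> k)) \<eta>))
      has_sum dual_adjoint M \<eta>) I" if "\<eta> \<in> antidual s\<^sub>2" for \<eta>
    by (rule has_sum_adjoint_antidual[OF bl adj[OF conj_functional_antidual[OF assms(7) that]]])
  have cpt: "compact_operator M" if "m \<in> c0 I"
    unfolding compact_operator_def
  proof (intro conjI allI impI bl compact_closure_if_near_compact)
    fix S :: "'a set" and e :: real
    assume "bounded S" "e > 0"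
    then obtain R where R: "R > 0" "\<And>f. f \<in> S \<Longrightarrow> norm f \<le> R"
      by (auto simp: bounded_pos)
    \<comment> \<open>The part of the symbol below \<open>d\<close> maps \<open>S\<close> into the ball of radius \<open>e\<close>; the rest,
      supported on the finite set \<open>F\<close>, is an operator of finite rank.\<close>
    define d where "d = e / (B\<^sub>2 * B\<^sub>1 * R)"
    have d: "d > 0" "B\<^sub>2 * B\<^sub>1 * d * R = e" using \<open>e > 0\<close> R B by (auto simp: d_def)
    define F where "F = {k\<in>I. norm (m k) \<ge> d}"
    have F: "finite F" "F \<subseteq> I"
      using finite_large_of_c0[OF that d(1)] by (auto simp: F_def)
    define m' where "m' k = (if k \<in> F then 0 else m k)" for k
    have m': "norm (m' k) \<le> d" if "k \<in> I" for k
      using that d(1) by (auto simp: m'_def F_def)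
    define K where "K = {\<Sum>k\<in>F. s\<^sub>2 (c k) (\<phi> k) |c. \<forall>k\<in>F. norm (c k) \<le> norm (m k) * (norm (\<psi> k) * R)}"
    have "\<exists>y\<in>K. dist (M f) y \<le> e" if "f \<in> S" for f
    proof
      let ?y = "\<Sum>k\<in>F. s\<^sub>2 (m k * blinfun_apply (\<psi> k) f) (\<phi> k)"
      have "norm (blinfun_apply (\<psi> k) f) \<le> norm (\<psi> k) * R" for k
        using norm_blinfun[of "\<psi> k" f] R(2)[OF that]
        by (meson mult_left_mono norm_ge_zero order_trans)
      then show "?y \<in> K"
        unfolding K_def by (auto simp: norm_mult intro!: exI mult_left_mono)
      have "((\<lambda>k. if k \<in> F then - s\<^sub>2 (m k * blinfun_apply (\<psi> k) f) (\<phi> k) else 0) has_sum - ?y) I"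
        using F by (intro has_sum_finite_neutralI[where B = F]) (auto simp: sum_negf)
      from has_sum_add[OF M[of f] this]
      have "((\<lambda>k. s\<^sub>2 (m' k * blinfun_apply (\<psi> k) f) (\<phi> k)) has_sum M f + - ?y) I"
        by (rule has_sum_cong[THEN iffD1, rotated])
           (auto simp: m'_def K_Banach_zero_left[OF assms(7)])
      then have "M f - ?y = (\<Sum>\<^sub>\<infinity>k\<in>I. s\<^sub>2 (m' k * blinfun_apply (\<psi> k) f) (\<phi> k))"
        by (simp add: infsumI)
      also have "norm \<dots> \<le> B\<^sub>2 * B\<^sub>1 * d * norm f"
        using d(1) by (intro conv(2) m') auto
      also have "\<dots> \<le> B\<^sub>2 * B\<^sub>1 * d * R"
        using B d(1) R(2)[OF that] by (intro mult_left_mono) auto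
      finally show "dist (M f) ?y \<le> e" using d(2) by (simp add: dist_norm)
    qed
    moreover have "compact K"
      unfolding K_def by (rule compact_finite_combinations[OF assms(7) F(1)])
    ultimately show "\<exists>K. compact K \<and> (\<forall>x\<in>M ` S. \<exists>y\<in>K. dist x y \<le> e)" by blast
  qed
  have mult: "dual_adjoint M \<eta> = multiplier scale_dual I a x (\<lambda>k. kappa (\<phi> k)) \<eta>"
    if "((\<lambda>k. scale_dual (a k) (tensor scale_dual (x k) (kappa (\<phi> k)) \<eta>))
      has_sum dual_adjoint M \<eta>) I" for \<eta> a and x :: "'i \<Rightarrow> ('a \<Rightarrow>\<^sub>L 'k)"
    using infsumI[OF that] by (simp add: multiplier_def tensor_def scale_dual_scale_dual)
  have real: "((\<lambda>k. scale_dual (conjg (m k)) (tensor scale_dual (\<psi> k) (kappa (\<phi> k)) \<eta>))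
      has_sum dual_adjoint M \<eta>) I" if "\<forall>k\<in>I. m k \<in> \<real>" "\<eta> \<in> dual s\<^sub>2" for \<eta>
    by (rule has_sum_cong[THEN iffD1, OF _ adj[OF that(2)]])
       (use that(1) in \<open>auto elim!: Reals_cases simp: conjg_of_real\<close>)
  show ?thesis
    by (intro conjI allI ballI impI sum lin bl onorm adj mult real anti cpt; blast)
qed

end
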